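(* Let $\phi(\alpha;q)=\sum_{n=0}^\infty \frac{q^{n^2}}{(-\alpha q;q^2)_n}$, and let $P_{do}$ denote the set of partitions into distinct parts with the smallest part being odd. Then \[ (-\alpha q;q)_\infty\,\phi(-\alpha q;-q)=1+\sum_{\nu \in P_{do}}\alpha^{l(\nu)}q^{|\nu|}+\sum_{k=1}^\infty (-1)^k q^{k^2}. \]
   Context: Notation: $(a;q)_n=(1-a)(1-aq)\cdots(1-aq^{n-1})$, $(a;q)_\infty=\prod_{n\ge0}(1-aq^n)$; identities of formal power series in $q$. For a partition $\nu$, $|\nu|$ is the sum of its parts and $l(\nu)$ its number of parts. *)

theory Defs
  imports "HOL-Analysis.Analysis"
begin

text \<open>Formal power series in q are elements of \<^typ>\<open>'a fps\<close>, with q rendered as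
  \<^const>\<open>fps_X\<close>. The infinite sums and products below are limits in the library's
  metric topology on \<^typ>\<open>'a fps\<close>, that is, coefficientwise stabilisation.\<close>

definition qpoch :: "'b::comm_ring_1 \<Rightarrow> 'b \<Rightarrow> nat \<Rightarrow> 'b" where
  "qpoch a q n = (\<Prod>k<n. 1 - a * q ^ k)"

definition qpoch_inf :: "'b::{comm_ring_1, t2_space} \<Rightarrow> 'b \<Rightarrow> 'b" where
  "qpoch_inf a q = (\<Prod>k. 1 - a * q ^ k)"

text \<open>Both arguments are power series, so that the substitution of \<open>-\<alpha>q\<close> and \<open>-q\<close> for the
  two arguments of \<open>\<phi>\<close> is ordinary function application.\<close>

definition phi :: "'a::field fps \<Rightarrow> 'a fps \<Rightarrow> 'a fps" where
  "phi \<alpha> q = (\<Sum>n. q ^ (n\<^sup>2) / qpoch (- \<alpha> * q) (q\<^sup>2) n)"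

text \<open>A partition is the finite multiset of its (positive) parts; \<^const>\<open>sum_mset\<close> gives
  \<open>|\<nu>|\<close> and \<^const>\<open>size\<close> gives \<open>l(\<nu>)\<close>.\<close>

definition partitions :: "nat multiset set" where
  "partitions = {\<nu>. 0 \<notin># \<nu>}"

text \<open>The empty partition has no smallest part and hence is excluded; it is the separate
  summand 1 in the theorem.\<close>

definition P_do :: "nat multiset set" where
  "P_do = {\<nu> \<in> partitions. (\<forall>i. count \<nu> i \<le> 1) \<and> \<nu> \<noteq> {#} \<and> odd (Min (set_mset \<nu>))}"

end

theory Submission
  imports Defs
begin

text \<open>With \<open>h(\<alpha>) = (-\<alpha>q;q)\<^sub>\<infinity> \<phi>(-\<alpha>q;-q)\<close>, telescoping the terms of
  \<open>\<phi>\<close> gives \<open>h(\<alpha>) = \<alpha>q (-\<alpha>q\<^sup>2;q)\<^sub>\<infinity> + h(\<alpha>q\<^sup>2)\<close>. Iterating,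
  \<open>h(\<alpha>)\<close> is the sum of \<open>\<alpha>q\<^sup>m (-\<alpha>q\<^bsup>m+1\<^esup>;q)\<^sub>\<infinity>\<close> over odd \<open>m\<close>, which generates
  the partitions into distinct parts with smallest part \<open>m\<close>, plus the limit \<open>h(0)\<close>, a theta
  series. Limits are handled as congruences modulo powers of \<open>q\<close>.\<close>

section \<open>Congruences modulo powers of q and coefficientwise limits\<close>

lemma fps_X_power_dvd_iff_nth:
  fixes f :: "'a::comm_ring_1 fps"
  shows "fps_X ^ n dvd f \<longleftrightarrow> (\<forall>k<n. fps_nth f k = 0)"
proof
  assume "fps_X ^ n dvd f"
  then show "\<forall>k<n. fps_nth f k = 0"
    by (auto simp: dvd_def fps_X_power_mult_nth)
next
  assume *: "\<forall>k<n. fps_nth f k = 0"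
  have "f = fps_X ^ n * fps_shift n f"
    using * by (auto simp: fps_eq_iff fps_X_power_mult_nth)
  then show "fps_X ^ n dvd f"
    by (rule dvdI)
qed

lemma fps_eq_if_fps_X_power_dvd:
  fixes f g :: "'a::comm_ring_1 fps"
  assumes "\<And>n. fps_X ^ n dvd f - g"
  shows "f = g"
proof (rule fps_ext)
  fix n
  show "fps_nth f n = fps_nth g n"
    using assms[of "Suc n"] unfolding fps_X_power_dvd_iff_nth by simp
qed

text \<open>Completeness with an explicit modulus: besides a limit it yields how far the finite
  stage \<open>f N\<close> already agrees with it, which is what lets later arguments trade limits
  for finite stages.\<close>

lemma fps_X_power_dvd_limit:
  fixes f :: "nat \<Rightarrow> 'a::comm_ring_1 fps"
  assumes "\<And>n. fps_X ^ n dvd f (Suc n) - f n"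
  shows "\<exists>L. \<forall>n N. n \<le> N \<longrightarrow> fps_X ^ n dvd f N - L"
proof -
  \<comment> \<open>From index \<open>Suc k\<close> on, consecutive stages agree modulo
    \<open>fps_X ^ Suc k\<close>, so coefficient \<open>k\<close> no longer changes;
    \<open>L\<close> reads it off there.\<close>
  define L where "L = Abs_fps (\<lambda>k. fps_nth (f (Suc k)) k)"
  have stable: "fps_nth (f N) k = fps_nth (f (Suc k)) k" if "Suc k \<le> N" for N k
    using that
  proof (induction N rule: dec_induct)
    case (step N)
    then show ?case
      using assms[of N] unfolding fps_X_power_dvd_iff_nth by simp
  qed simp
  have "fps_X ^ n dvd f N - L" if "n \<le> N" for n N
    unfolding fps_X_power_dvd_iff_nth
  proof safe
    fix k assume "k < n"
    with that have "fps_nth (f N) k = fps_nth (f (Suc k)) k"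
      by (intro stable) simp
    then show "fps_nth (f N - L) k = 0"
      by (simp add: L_def)
  qed
  then show ?thesis
    by blast
qed

lemma LIMSEQ_fpsI:
  fixes f :: "nat \<Rightarrow> 'a::comm_ring_1 fps"
  assumes "\<And>n N. n \<le> N \<Longrightarrow> fps_X ^ n dvd f N - L"
  shows "f \<longlonglongrightarrow> L"
proof (rule tendsto_fpsI)
  fix n
  show "\<forall>\<^sub>F N in sequentially. fps_nth (f N) n = fps_nth L n"
    using eventually_ge_at_top[of "Suc n"]
  proof eventually_elim
    case (elim N)
    from assms[OF this] show ?case
      unfolding fps_X_power_dvd_iff_nth by simp
  qed
qed

text \<open>All terms from index \<open>n\<close> on are divisible by \<open>fps_X ^ n\<close>,
  hence so is the tail. The same bound makes the series converge, so \<open>suminf\<close> is its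
  genuine limit.\<close>

lemma fps_X_power_dvd_suminf_diff:
  fixes f :: "nat \<Rightarrow> 'a::comm_ring_1 fps"
  assumes "\<And>n. fps_X ^ n dvd f n"
  shows "fps_X ^ n dvd suminf f - (\<Sum>k<n. f k)"
proof -
  have "\<And>n. fps_X ^ n dvd (\<Sum>k<Suc n. f k) - (\<Sum>k<n. f k)"
    using assms by simp
  from fps_X_power_dvd_limit[OF this]
  obtain L where L: "\<And>n N. n \<le> N \<Longrightarrow> fps_X ^ n dvd (\<Sum>k<N. f k) - L"
    by blast
  have "f sums L"
    unfolding sums_def by (rule LIMSEQ_fpsI) (rule L)
  then show ?thesis
    using L[of n n] unfolding fps_X_power_dvd_iff_nth
    by (simp add: sums_unique[symmetric])
qed

section \<open>Finite and infinite q-shifted factorials\<close>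

lemma qpoch_Suc_shift: "qpoch a q (Suc n) = (1 - a) * qpoch (a * q) q n"
  unfolding qpoch_def by (subst prod.lessThan_Suc_shift) (simp add: mult.assoc)

lemma qpoch_Suc: "qpoch a q (Suc n) = qpoch a q n * (1 - a * q ^ n)"
  by (simp add: qpoch_def)

text \<open>Every factor \<open>1 - a * q ^ k\<close> is congruent to 1 modulo
  \<open>d\<close>.\<close>

lemma dvd_qpoch_minus_1:
  fixes a q :: "'b::comm_ring_1"
  assumes "d dvd a"
  shows "d dvd qpoch a q n - 1"
proof (induction n)
  case (Suc n)
  have "qpoch a q (Suc n) - 1 = (qpoch a q n - 1) - a * (qpoch a q n * q ^ n)"
    by (simp add: qpoch_Suc algebra_simps)
  then show ?case
    by (simp only: dvd_diff[OF Suc dvd_mult2[OF assms]])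
qed (simp add: qpoch_def)

text \<open>Appending the factor with index \<open>n\<close> changes the product by a multiple of
  \<open>fps_X ^ n\<close>, so the partial products converge at this rate. The assumption on
  \<open>a\<close> serves to make the limit nonzero.\<close>

lemma fps_X_power_dvd_qpoch_inf_diff:
  fixes a :: "'a::field fps"
  assumes "fps_X dvd a"
  shows "fps_X ^ n dvd qpoch_inf a fps_X - qpoch a fps_X n"
proof -
  have "\<And>n. fps_X ^ n dvd qpoch a fps_X (Suc n) - qpoch a fps_X n"
    by (simp add: qpoch_Suc algebra_simps)
  from fps_X_power_dvd_limit[OF this]
  obtain L where L: "\<And>n N. n \<le> N \<Longrightarrow> fps_X ^ n dvd qpoch a fps_X N - L"
    by blast
  have lim: "(\<lambda>n. \<Prod>k\<le>n. 1 - a * fps_X ^ k) \<longlonglongrightarrow> L"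
  proof (rule LIMSEQ_fpsI)
    fix n N :: nat
    assume "n \<le> N"
    then show "fps_X ^ n dvd (\<Prod>k\<le>N. 1 - a * fps_X ^ k) - L"
      using L[of n "Suc N"] by (simp add: qpoch_def lessThan_Suc_atMost)
  qed
  \<comment> \<open>\<open>has_prod\<close> with no factors removed demands a nonzero limit.
    Comparing with the one-factor product shows that \<open>L\<close> has constant term 1.\<close>
  have "fps_X dvd (qpoch a fps_X 1 - 1) - (qpoch a fps_X 1 - L)"
    using dvd_qpoch_minus_1[OF assms, of fps_X 1] L[of 1 1]
    by (metis dvd_diff order_refl power_one_right)
  then have "fps_X ^ 1 dvd L - 1"
    by simp
  then have "fps_nth L 0 = 1"
    unfolding fps_X_power_dvd_iff_nth by simp
  then have "L \<noteq> 0"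
    by auto
  with lim have "(\<lambda>k. 1 - a * fps_X ^ k) has_prod L"
    by (simp add: has_prod_def raw_has_prod_def)
  then have "qpoch_inf a fps_X = L"
    unfolding qpoch_inf_def by (rule has_prod_unique[symmetric])
  then show ?thesis
    using L[of n n] by (simp add: dvd_diff_commute[of _ L])
qed

text \<open>The finite identity with \<open>Suc n\<close> factors on the left and \<open>n\<close>
  on the right approximates both sides modulo \<open>fps_X ^ n\<close>.\<close>

lemma qpoch_inf_shift:
  fixes a :: "'a::field fps"
  assumes "fps_X dvd a"
  shows "qpoch_inf a fps_X = (1 - a) * qpoch_inf (a * fps_X) fps_X"
proof (rule fps_eq_if_fps_X_power_dvd)
  fix n
  have "fps_X ^ n dvd qpoch_inf a fps_X - qpoch a fps_X (Suc n)"
    using fps_X_power_dvd_qpoch_inf_diff[OF assms, of "Suc n"] le_imp_power_dvd[of n "Suc n"]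
    by (meson dvd_trans le_SucI order_refl)
  moreover have "fps_X ^ n dvd (1 - a) * (qpoch_inf (a * fps_X) fps_X - qpoch (a * fps_X) fps_X n)"
    using fps_X_power_dvd_qpoch_inf_diff[of "a * fps_X" n] by simp
  ultimately have "fps_X ^ n dvd (qpoch_inf a fps_X - qpoch a fps_X (Suc n))
      - (1 - a) * (qpoch_inf (a * fps_X) fps_X - qpoch (a * fps_X) fps_X n)"
    by (rule dvd_diff)
  then show "fps_X ^ n dvd qpoch_inf a fps_X - (1 - a) * qpoch_inf (a * fps_X) fps_X"
    by (simp add: qpoch_Suc_shift algebra_simps)
qed

section \<open>The series phi and its functional equation\<close>

text \<open>The summand of \<open>phi (- C * fps_X) (- fps_X)\<close>: the sign
  \<open>(- 1) ^ n\<^sup>2\<close> equals \<open>(- 1) ^ n\<close>, and the minus signs of the two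
  arguments combine inside the factorial. \<open>C\<close> is a power series rather than a scalar,
  so that \<open>C * fps_X\<^sup>2\<close> may replace it.\<close>

definition phi_term :: "'a::field fps \<Rightarrow> nat \<Rightarrow> 'a fps" where
  "phi_term C n = (- 1) ^ n * fps_X ^ n\<^sup>2 * inverse (qpoch (- C * fps_X\<^sup>2) (fps_X\<^sup>2) n)"

text \<open>Constant term 1 makes the denominators of \<open>phi\<close> units, so their inverses
  are true inverses.\<close>

lemma fps_nth_qpoch_0: "fps_nth (qpoch (- C * fps_X\<^sup>2) q n) 0 = (1::'a::field)"
  by (induction n) (simp_all add: qpoch_def)

lemma phi_eq_suminf: "phi (- C * fps_X) (- fps_X) = suminf (phi_term C)"
proof -
  have "(- fps_X) ^ n\<^sup>2 / qpoch (- (- C * fps_X) * - fps_X) ((- fps_X)\<^sup>2) n = phi_term C n" for n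
  proof -
    have "(- 1 :: 'a fps) ^ n\<^sup>2 = (- 1) ^ n"
      by (simp add: minus_one_power_iff)
    moreover have "(- fps_X :: 'a fps) ^ n\<^sup>2 = (- 1) ^ n\<^sup>2 * fps_X ^ n\<^sup>2"
      by (rule power_minus)
    moreover have "- (- C * fps_X) * - fps_X = - C * fps_X\<^sup>2"
      by (simp add: power2_eq_square)
    ultimately show ?thesis
      by (simp add: phi_term_def fps_divide_unit fps_nth_qpoch_0 del: mult_minus_left)
  qed
  then show ?thesis
    by (simp only: phi_def)
qed

lemma fps_X_power_dvd_phi_term: "fps_X ^ n dvd phi_term C n"
proof -
  have "fps_X ^ n dvd (fps_X :: 'a fps) ^ n\<^sup>2"
    by (rule le_imp_power_dvd) (simp add: power2_eq_square)
  then show ?thesis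
    by (simp add: phi_term_def)
qed

text \<open>Put everything over the denominator \<open>D (Suc n)\<close> and let y stand for q^(2n).
  After removing the common factor \<open>s * d * (1 + C * fps_X\<^sup>2)\<close> there remains (1 +
  Cq)(1 + Cq^2 y) - 1 = Cq(1 + Cq^2 y + qy).\<close>

lemma phi_term_telescope:
  fixes C :: "'a::field fps"
  shows "(1 + C * fps_X) * (1 + C * fps_X\<^sup>2) * phi_term C n - phi_term (C * fps_X\<^sup>2) n
    = C * fps_X * (1 + C * fps_X\<^sup>2) * (phi_term C n - phi_term C (Suc n))"
proof -
  define D where "D = (\<lambda>n. qpoch (- C * fps_X\<^sup>2) (fps_X\<^sup>2) n)"
  define E where "E = qpoch (- (C * fps_X\<^sup>2) * fps_X\<^sup>2) (fps_X\<^sup>2) n"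
  define s where "s = (- 1) ^ n * (fps_X :: 'a fps) ^ n\<^sup>2"
  define y where "y = (fps_X :: 'a fps) ^ (2 * n)"
  have D1: "D (Suc n) = (1 + C * fps_X\<^sup>2) * E"
    by (simp add: D_def E_def qpoch_Suc_shift)
  have D2: "D (Suc n) = D n * (1 + C * fps_X\<^sup>2 * y)"
    by (simp add: D_def y_def qpoch_Suc power_mult)
  have s: "(- 1) ^ Suc n * (fps_X :: 'a fps) ^ (Suc n)\<^sup>2 = - (s * y * fps_X)"
  proof -
    have "(Suc n)\<^sup>2 = n\<^sup>2 + 2 * n + 1"
      by (simp add: power2_eq_square)
    then have "(fps_X :: 'a fps) ^ (Suc n)\<^sup>2 = fps_X ^ n\<^sup>2 * y * fps_X"
      by (simp only: y_def power_add power_one_right)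
    then show ?thesis
      by (simp only: s_def power_Suc mult_minus_left mult_1_left mult.assoc)
  qed
  have [simp]: "fps_nth (D k) 0 = 1" for k
    unfolding D_def by (rule fps_nth_qpoch_0)
  have [simp]: "fps_nth E 0 = 1"
    unfolding E_def by (rule fps_nth_qpoch_0)
  have inv: "inverse (D k) * D k = 1" "inverse E * E = 1" for k
    by (simp_all add: inverse_mult_eq_1)
  \<comment> \<open>The inverse of a factor \<open>a\<close> is \<open>w\<close> times the inverse
    of the product \<open>a * w\<close>. Both \<open>inverse (D n)\<close> and
    \<open>inverse E\<close> thus become multiples of the single element \<open>d\<close>.\<close>
  have unique: "b = x * w" if "x * (a * w) = 1" "b * a = 1" for a b w x :: "'a fps"
  proof -
    have "b = x * (a * w) * b"
      using that(1) by simp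
    also have "\<dots> = x * w * (b * a)"
      by (simp only: mult_ac)
    finally show ?thesis
      using that(2) by simp
  qed
  define d where "d = inverse (D (Suc n))"
  have dn: "inverse (D n) = d * (1 + C * fps_X\<^sup>2 * y)"
    by (rule unique) (use inv(1)[of "Suc n"] D2 inv(1)[of n] in \<open>simp_all only: d_def\<close>)
  have e: "inverse E = d * (1 + C * fps_X\<^sup>2)"
    by (rule unique) (use inv(1)[of "Suc n"] D1 inv(2) in \<open>simp_all only: d_def mult.commute[of E]\<close>)
  have t: "phi_term C n = s * inverse (D n)" "phi_term (C * fps_X\<^sup>2) n = s * inverse E"
    "phi_term C (Suc n) = - (s * y * fps_X) * d"
    unfolding phi_term_def s by (simp_all add: s_def D_def E_def d_def)
  show ?thesis
    unfolding t dn e by (simp add: power2_eq_square algebra_simps)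
qed

text \<open>Summing \<open>phi_term_telescope\<close> over \<open>k < n\<close> leaves the boundary
  terms \<open>phi_term C 0 = 1\<close> and \<open>phi_term C n\<close>; the latter is divisible by
  \<open>fps_X ^ n\<close> and disappears in the limit.\<close>

lemma phi_shift:
  fixes C :: "'a::field fps"
  shows "(1 + C * fps_X) * (1 + C * fps_X\<^sup>2) * suminf (phi_term C)
    = C * fps_X * (1 + C * fps_X\<^sup>2) + suminf (phi_term (C * fps_X\<^sup>2))"
proof (rule fps_eq_if_fps_X_power_dvd)
  fix n
  define S where "S = (\<Sum>k<n. phi_term C k)"
  define S' where "S' = (\<Sum>k<n. phi_term (C * fps_X\<^sup>2) k)"
  define u where "u = (1 + C * fps_X) * (1 + C * fps_X\<^sup>2)"
  define v where "v = C * fps_X * (1 + C * fps_X\<^sup>2)"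
  have "u * S - S' = (\<Sum>k<n. u * phi_term C k - phi_term (C * fps_X\<^sup>2) k)"
    by (simp add: S_def S'_def sum_subtractf sum_distrib_left)
  also have "\<dots> = (\<Sum>k<n. v * (phi_term C k - phi_term C (Suc k)))"
    by (simp only: u_def v_def phi_term_telescope)
  also have "\<dots> = v * (phi_term C 0 - phi_term C n)"
    by (simp only: sum_lessThan_telescope' flip: sum_distrib_left)
  also have "phi_term C 0 = 1"
    by (simp add: phi_term_def qpoch_def)
  finally have *: "u * S = S' + v * (1 - phi_term C n)"
    by (simp add: algebra_simps)
  have "fps_X ^ n dvd u * (suminf (phi_term C) - S)
      - (suminf (phi_term (C * fps_X\<^sup>2)) - S') - v * phi_term C n"
    unfolding S_def S'_def
    by (intro dvd_diff dvd_mult fps_X_power_dvd_suminf_diff fps_X_power_dvd_phi_term)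
  also have "u * (suminf (phi_term C) - S)
      - (suminf (phi_term (C * fps_X\<^sup>2)) - S') - v * phi_term C n
    = u * suminf (phi_term C) - (v + suminf (phi_term (C * fps_X\<^sup>2)))"
    using * by (simp add: algebra_simps)
  finally show "fps_X ^ n dvd u * suminf (phi_term C) - (v + suminf (phi_term (C * fps_X\<^sup>2)))" .
qed

section \<open>The product h, its iteration and its theta limit\<close>

text \<open>This is the h of the overview, with a power series as its argument.\<close>

definition phi_prod :: "'a::field fps \<Rightarrow> 'a fps" where
  "phi_prod C = qpoch_inf (- C * fps_X) fps_X * suminf (phi_term C)"

text \<open>Splitting off two factors gives (-Cq;q)_inf = (1 + Cq)(1 + Cq^2) P, where P =
  (-Cq^3;q)_inf is exactly the product belonging to the argument \<open>C * fps_X\<^sup>2\<close>.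
  So the claim is \<open>phi_shift\<close> multiplied by P, one factor being absorbed again.\<close>

lemma phi_prod_shift:
  "phi_prod C = C * fps_X * qpoch_inf (- C * fps_X\<^sup>2) fps_X + phi_prod (C * fps_X\<^sup>2)"
proof -
  define P where "P = qpoch_inf (- C * fps_X ^ 3) fps_X"
  have 1: "qpoch_inf (- C * fps_X) fps_X = (1 + C * fps_X) * qpoch_inf (- C * fps_X\<^sup>2) fps_X"
    by (subst qpoch_inf_shift) (simp_all add: power2_eq_square mult.assoc)
  have 2: "qpoch_inf (- C * fps_X\<^sup>2) fps_X = (1 + C * fps_X\<^sup>2) * P"
    unfolding P_def by (subst qpoch_inf_shift) (simp_all add: power2_eq_square power3_eq_cube mult.assoc)
  have 3: "qpoch_inf (- (C * fps_X\<^sup>2) * fps_X) fps_X = P"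
    by (simp add: P_def power2_eq_square power3_eq_cube mult.assoc)
  show ?thesis
    unfolding phi_prod_def 3 using phi_shift[of C] unfolding 1 2 by algebra
qed

lemma phi_prod_iterate:
  "phi_prod C = (\<Sum>i<N. C * fps_X ^ (2 * i + 1) * qpoch_inf (- C * fps_X ^ (2 * i + 2)) fps_X)
    + phi_prod (C * fps_X ^ (2 * N))"
proof (induction N)
  case (Suc N)
  show ?case
    by (subst Suc, subst phi_prod_shift) (simp add: power2_eq_square mult_ac)
qed simp

text \<open>Modulo \<open>fps_X ^ m\<close> the infinite product and all denominators of
  \<open>phi\<close> are 1, so only the numerators (-1)^k q^(k^2) survive. This replaces the passage
  to h(0) by a congruence.\<close>

lemma fps_X_power_dvd_phi_prod_diff:
  fixes C :: "'a::field fps"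
  assumes C: "fps_X ^ m dvd C"
  shows "fps_X ^ m dvd phi_prod C - (1 + (\<Sum>k. (- 1) ^ Suc k * fps_X ^ (Suc k)\<^sup>2))"
proof -
  define P where "P = qpoch_inf (- C * fps_X) fps_X"
  define F where "F = suminf (phi_term C)"
  define s where "s = (\<lambda>k. (- 1) ^ k * (fps_X :: 'a fps) ^ k\<^sup>2)"
  have P: "fps_X ^ m dvd P - 1"
  proof -
    have "fps_X ^ m dvd (P - qpoch (- C * fps_X) fps_X m) + (qpoch (- C * fps_X) fps_X m - 1)"
      unfolding P_def using C
      by (intro dvd_add fps_X_power_dvd_qpoch_inf_diff dvd_qpoch_minus_1) auto
    then show ?thesis by simp
  qed
  have terms: "fps_X ^ m dvd phi_term C k - s k" for k
  proof -
    define D where "D = qpoch (- C * fps_X\<^sup>2) (fps_X\<^sup>2) k"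
    have "inverse D * D = 1"
      unfolding D_def by (rule inverse_mult_eq_1) (simp add: fps_nth_qpoch_0 del: mult_minus_left)
    moreover have "phi_term C k = s k * inverse D"
      by (simp add: phi_term_def s_def D_def)
    moreover have "s k * inverse D * (D - 1) = s k * (inverse D * D) - s k * inverse D"
      by (simp only: right_diff_distrib mult.assoc mult_1_right)
    ultimately have "phi_term C k - s k = - (s k * inverse D * (D - 1))"
      by simp
    moreover have "fps_X ^ m dvd D - 1"
      unfolding D_def using C by (intro dvd_qpoch_minus_1) auto
    ultimately show ?thesis by simp
  qed
  \<comment> \<open>One term beyond \<open>m\<close> is included because the theta series of the
    claim starts at index 1: \<open>s 0 = 1\<close> together with its first \<open>m\<close> terms
    makes \<open>Suc m\<close> terms. The extra \<open>s m\<close> is itself divisible by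
    \<open>fps_X ^ m\<close>.\<close>
  have F: "fps_X ^ m dvd F - (\<Sum>k<Suc m. s k)"
  proof -
    have "fps_X ^ m dvd F - (\<Sum>k<m. phi_term C k)"
      unfolding F_def by (intro fps_X_power_dvd_suminf_diff fps_X_power_dvd_phi_term)
    moreover have "fps_X ^ m dvd (\<Sum>k<m. phi_term C k - s k)"
      by (intro dvd_sum terms)
    moreover have "fps_X ^ m dvd s m"
      unfolding s_def by (intro dvd_mult le_imp_power_dvd) (simp add: power2_eq_square)
    ultimately have "fps_X ^ m dvd (F - (\<Sum>k<m. phi_term C k)) + (\<Sum>k<m. phi_term C k - s k) - s m"
      by (rule dvd_diff[OF dvd_add])
    then show ?thesis by (simp add: sum_subtractf algebra_simps)
  qed
  have s: "fps_X ^ m dvd (\<Sum>k. s (Suc k)) - (\<Sum>k<m. s (Suc k))"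
  proof (rule fps_X_power_dvd_suminf_diff)
    fix n
    show "fps_X ^ n dvd s (Suc n)"
      unfolding s_def by (intro dvd_mult le_imp_power_dvd) (simp add: power2_eq_square)
  qed
  have "fps_X ^ m dvd (P - 1) * F + (F - (\<Sum>k<Suc m. s k)) - ((\<Sum>k. s (Suc k)) - (\<Sum>k<m. s (Suc k)))"
    by (rule dvd_diff[OF dvd_add[OF dvd_mult2[OF P] F] s])
  also have "\<dots> = P * F - (1 + (\<Sum>k. s (Suc k)))"
    by (subst sum.lessThan_Suc_shift) (simp add: s_def algebra_simps)
  finally show ?thesis
    by (simp only: phi_prod_def P_def F_def s_def)
qed

section \<open>The generating function of \<open>P_do\<close>\<close>

lemma prod_one_plus_eq_sum_Pow:
  fixes f :: "'b \<Rightarrow> 'a::comm_semiring_1"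
  assumes "finite A"
  shows "(\<Prod>x\<in>A. 1 + f x) = (\<Sum>S\<in>Pow A. prod f S)"
  using prod_add[OF assms, of f "\<lambda>_. 1"] by (simp add: add.commute)

text \<open>A partition into distinct parts is a set; it splits into its smallest part
  \<open>2 * i + 1\<close> and the set \<open>S\<close> of its larger parts. With all parts at most
  \<open>2 * M\<close>, the smallest odd part is at most \<open>2 * M - 1\<close>, whence
  \<open>i < M\<close>.\<close>

lemma bij_betw_P_do:
  "bij_betw (\<lambda>(i, S). mset_set (insert (2 * i + 1) S))
    (SIGMA i:{..<M}. Pow {2 * i + 2..2 * M}) {\<nu> \<in> P_do. set_mset \<nu> \<subseteq> {..2 * M}}"
  (is "bij_betw ?f ?A ?B")
proof (rule bij_betwI[where g = "\<lambda>\<nu>. (Min (set_mset \<nu>) div 2, set_mset \<nu> - {Min (set_mset \<nu>)})"])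
  have props: "finite S" "2 * i + 1 \<notin> S" "Min (insert (2 * i + 1) S) = 2 * i + 1"
    if "(i, S) \<in> ?A" for i S
  proof -
    show "finite S" using that finite_subset by auto
    show "2 * i + 1 \<notin> S" using that by auto
    show "Min (insert (2 * i + 1) S) = 2 * i + 1"
      using that \<open>finite S\<close> by (intro Min_eqI) auto
  qed
  show "?f \<in> ?A \<rightarrow> ?B"
  proof
    fix p assume "p \<in> ?A"
    then obtain i S where iS: "p = (i, S)" "i < M" "S \<subseteq> {2 * i + 2..2 * M}" "(i, S) \<in> ?A"
      by auto
    have "set_mset (?f p) = insert (2 * i + 1) S"
      using props(1)[OF iS(4)] iS(1) by simp
    moreover have "count (?f p) x \<le> 1" for x
      by (simp add: iS(1) count_mset_set')
    ultimately show "?f p \<in> ?B"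
      using iS(2,3) props(3)[OF iS(4)] unfolding P_do_def partitions_def
      by (auto simp del: Min_insert simp flip: set_mset_eq_empty_iff)
  qed
  have Min_set: "Min (set_mset \<nu>) \<in># \<nu>" "\<And>x. x \<in># \<nu> \<Longrightarrow> Min (set_mset \<nu>) \<le> x"
    "odd (Min (set_mset \<nu>))" if "\<nu> \<in> ?B" for \<nu>
    using that by (auto simp: P_do_def)
  show "(\<lambda>\<nu>. (Min (set_mset \<nu>) div 2, set_mset \<nu> - {Min (set_mset \<nu>)})) \<in> ?B \<rightarrow> ?A"
  proof
    fix \<nu> assume \<nu>: "\<nu> \<in> ?B"
    define m where "m = Min (set_mset \<nu>)"
    obtain i where i: "m = 2 * i + 1"
      using Min_set(3)[OF \<nu>] by (auto simp: m_def elim: oddE)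
    have "m \<le> 2 * M"
      using \<nu> Min_set(1)[OF \<nu>] by (auto simp: m_def)
    moreover have "m < x" if "x \<in># \<nu>" "x \<noteq> m" for x
      using Min_set(2)[OF \<nu> that(1)] that(2) by (simp add: m_def)
    ultimately show "(Min (set_mset \<nu>) div 2, set_mset \<nu> - {Min (set_mset \<nu>)}) \<in> ?A"
      using \<nu> i by (fastforce simp flip: m_def)
  qed
  show "(Min (set_mset (?f p)) div 2, set_mset (?f p) - {Min (set_mset (?f p))}) = p"
    if "p \<in> ?A" for p
    using that props by (cases p) (auto simp del: Min_insert)
  show "?f (Min (set_mset \<nu>) div 2, set_mset \<nu> - {Min (set_mset \<nu>)}) = \<nu>" if "\<nu> \<in> ?B" for \<nu>
  proof -
    \<comment> \<open>Multiplicities at most 1 allow the multiset to be recovered from its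
      support.\<close>
    have "mset_set (set_mset \<nu>) = \<nu>"
    proof (rule multiset_eqI)
      fix x
      have "count \<nu> x \<le> 1"
        using that by (simp add: P_do_def)
      moreover have "count \<nu> x = 0 \<longleftrightarrow> x \<notin># \<nu>"
        by (rule count_eq_zero_iff)
      ultimately have "count \<nu> x = (if x \<in># \<nu> then 1 else 0)"
        by (metis le_less_linear less_one nle_le order_antisym)
      then show "count (mset_set (set_mset \<nu>)) x = count \<nu> x"
        by (simp only: count_mset_set' finite_set_mset simp_thms)
    qed
    then show ?thesis
      using Min_set[OF that] by (simp add: insert_absorb)
  qed
qed

text \<open>The smallest part contributes \<open>A * q ^ (2 * i + 1)\<close>. The free choice of
  larger parts is the expansion of the product of the \<open>1 + A * q ^ k\<close> for
  \<open>k\<close> from \<open>2 * i + 2\<close> to \<open>2 * M\<close>, which has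
  \<open>2 * M - (2 * i + 1)\<close> factors.\<close>

lemma sum_P_do_eq:
  fixes A :: "'a::comm_ring_1"
  shows "(\<Sum>\<nu> | \<nu> \<in> P_do \<and> set_mset \<nu> \<subseteq> {..2 * M}. A ^ size \<nu> * q ^ sum_mset \<nu>)
    = (\<Sum>i<M. A * q ^ (2 * i + 1) * qpoch (- A * q ^ (2 * i + 2)) q (2 * M - (2 * i + 1)))"
proof -
  have weight: "A ^ size (mset_set S) * q ^ sum_mset (mset_set S) = (\<Prod>k\<in>S. A * q ^ k)"
    for S :: "nat set"
  proof -
    have "sum_mset (mset_set S) = (\<Sum>k\<in>S. k)"
      by (simp add: sum_unfold_sum_mset)
    then show ?thesis
      by (simp add: prod.distrib power_sum)
  qed
  have "(\<Sum>\<nu> | \<nu> \<in> P_do \<and> set_mset \<nu> \<subseteq> {..2 * M}. A ^ size \<nu> * q ^ sum_mset \<nu>)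
    = (\<Sum>(i, S)\<in>(SIGMA i:{..<M}. Pow {2 * i + 2..2 * M}). \<Prod>k\<in>insert (2 * i + 1) S. A * q ^ k)"
    by (subst sum.reindex_bij_betw[OF bij_betw_P_do, symmetric]) (simp only: weight case_prod_unfold)
  also have "\<dots> = (\<Sum>i<M. \<Sum>S\<in>Pow {2 * i + 2..2 * M}. \<Prod>k\<in>insert (2 * i + 1) S. A * q ^ k)"
    by (rule sum.Sigma[symmetric]) auto
  also have "\<dots> = (\<Sum>i<M. A * q ^ (2 * i + 1) * qpoch (- A * q ^ (2 * i + 2)) q (2 * M - (2 * i + 1)))"
  proof (rule sum.cong[OF refl])
    fix i assume "i \<in> {..<M}"
    have "(\<Sum>S\<in>Pow {2 * i + 2..2 * M}. \<Prod>k\<in>insert (2 * i + 1) S. A * q ^ k)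
      = (\<Sum>S\<in>Pow {2 * i + 2..2 * M}. A * q ^ (2 * i + 1) * (\<Prod>k\<in>S. A * q ^ k))"
    proof (rule sum.cong[OF refl])
      fix S assume S: "S \<in> Pow {2 * i + 2..2 * M}"
      then have "finite S" "2 * i + 1 \<notin> S"
        using finite_subset by auto
      then show "(\<Prod>k\<in>insert (2 * i + 1) S. A * q ^ k) = A * q ^ (2 * i + 1) * (\<Prod>k\<in>S. A * q ^ k)"
        by (rule prod.insert)
    qed
    also have "\<dots> = A * q ^ (2 * i + 1) * (\<Prod>k\<in>{2 * i + 2..2 * M}. 1 + A * q ^ k)"
      by (simp add: prod_one_plus_eq_sum_Pow sum_distrib_left)
    also have "(\<Prod>k\<in>{2 * i + 2..2 * M}. 1 + A * q ^ k)
      = (\<Prod>k<2 * M - (2 * i + 1). 1 + A * q ^ (k + (2 * i + 2)))"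
      by (rule sym, rule prod.reindex_bij_witness[where
            i = "\<lambda>k. k - (2 * i + 2)" and j = "\<lambda>k. k + (2 * i + 2)"]) auto
    also have "\<dots> = qpoch (- A * q ^ (2 * i + 2)) q (2 * M - (2 * i + 1))"
      by (simp add: qpoch_def power_add mult_ac)
    finally show "(\<Sum>S\<in>Pow {2 * i + 2..2 * M}. \<Prod>k\<in>insert (2 * i + 1) S. A * q ^ k)
      = A * q ^ (2 * i + 1) * qpoch (- A * q ^ (2 * i + 2)) q (2 * M - (2 * i + 1))" .
  qed
  finally show ?thesis .
qed

lemma finite_P_do_bounded: "finite {\<nu> \<in> P_do. set_mset \<nu> \<subseteq> {..2 * M}}"
  using bij_betw_finite[OF bij_betw_P_do[of M]] by simp

text \<open>The coefficient of q^n sees only partitions of n, whose parts are at most n. These are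
  finitely many, so the sum converges, and for \<open>n < 2 * M\<close> the truncation to parts at
  most \<open>2 * M\<close> already contains them all.\<close>

lemma fps_X_power_dvd_infsum_P_do_diff:
  fixes \<alpha> :: "'a::field"
  defines "f \<equiv> (\<lambda>\<nu>. fps_const \<alpha> ^ size \<nu> * fps_X ^ sum_mset \<nu>)"
  shows "fps_X ^ (2 * M) dvd infsum f P_do - (\<Sum>\<nu> | \<nu> \<in> P_do \<and> set_mset \<nu> \<subseteq> {..2 * M}. f \<nu>)"
proof -
  have nth: "fps_nth (f \<nu>) n = (if sum_mset \<nu> = n then \<alpha> ^ size \<nu> else 0)" for \<nu> n
    by (simp add: f_def)
  have bounded: "set_mset \<nu> \<subseteq> {..2 * M}" if "fps_nth (f \<nu>) n \<noteq> 0" "n \<le> 2 * M" for \<nu> n M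
  proof
    fix x assume "x \<in># \<nu>"
    then have "x \<le> sum_mset \<nu>"
      by (metis le_add1 multi_member_split sum_mset.add_mset)
    with that show "x \<in> {..2 * M}"
      by (auto simp: nth split: if_splits)
  qed
  have fin: "finite {\<nu> \<in> P_do. fps_nth (f \<nu>) n \<noteq> 0}" for n
    by (rule finite_subset[OF _ finite_P_do_bounded[of n]]) (use bounded[of _ n n] in auto)
  have "(f has_sum Abs_fps (\<lambda>n. \<Sum>\<nu> | \<nu> \<in> P_do \<and> fps_nth (f \<nu>) n \<noteq> 0. fps_nth (f \<nu>) n)) P_do"
    by (rule has_sum_fpsI) (use fin in auto)
  then have "infsum f P_do = Abs_fps (\<lambda>n. \<Sum>\<nu> | \<nu> \<in> P_do \<and> fps_nth (f \<nu>) n \<noteq> 0. fps_nth (f \<nu>) n)"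
    by (rule infsumI)
  moreover have "(\<Sum>\<nu> | \<nu> \<in> P_do \<and> fps_nth (f \<nu>) n \<noteq> 0. fps_nth (f \<nu>) n)
      = (\<Sum>\<nu> | \<nu> \<in> P_do \<and> set_mset \<nu> \<subseteq> {..2 * M}. fps_nth (f \<nu>) n)" if "n < 2 * M" for n
    using bounded[of _ n M] that finite_P_do_bounded by (intro sum.mono_neutral_left) auto
  ultimately show ?thesis
    by (simp add: fps_X_power_dvd_iff_nth fps_sum_nth)
qed

section \<open>Assembling the identity from congruences modulo q^(2m)\<close>

theorem theorem5p3:
  fixes \<alpha> :: "'a::field"
  defines "q \<equiv> (fps_X :: 'a fps)" and "A \<equiv> fps_const \<alpha>"
  shows "qpoch_inf (- A * q) q * phi (- A * q) (- q) =
           1 + (\<Sum>\<^sub>\<infinity>\<nu>\<in>P_do. A ^ size \<nu> * q ^ sum_mset \<nu>)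
             + (\<Sum>k. (-1) ^ Suc k * q ^ ((Suc k)\<^sup>2))"
proof -
  define W where "W = (\<Sum>\<^sub>\<infinity>\<nu>\<in>P_do. A ^ size \<nu> * q ^ sum_mset \<nu>)"
  define T where "T = 1 + (\<Sum>k. (-1) ^ Suc k * q ^ ((Suc k)\<^sup>2))"
  have "phi_prod A = W + T"
  proof (rule fps_eq_if_fps_X_power_dvd)
    fix m
    \<comment> \<open>\<open>S\<close> comes from \<open>m\<close> iterations of the functional
      equation; \<open>S'\<close> is its truncation to parts at most \<open>2 * m\<close> and links
      it to the partition sum \<open>W\<close>.\<close>
    define S where "S = (\<Sum>i<m. A * q ^ (2 * i + 1) * qpoch_inf (- A * q ^ (2 * i + 2)) q)"
    define S' where
      "S' = (\<Sum>i<m. A * q ^ (2 * i + 1) * qpoch (- A * q ^ (2 * i + 2)) q (2 * m - (2 * i + 1)))"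
    have "q ^ (2 * m) dvd S - S'"
      unfolding S_def S'_def sum_subtractf[symmetric] right_diff_distrib[symmetric]
    proof (rule dvd_sum)
      fix i assume i: "i \<in> {..<m}"
      define D where "D = qpoch_inf (- A * q ^ (2 * i + 2)) q
        - qpoch (- A * q ^ (2 * i + 2)) q (2 * m - (2 * i + 1))"
      have "q ^ (2 * m - (2 * i + 1)) dvd D"
        unfolding D_def q_def by (rule fps_X_power_dvd_qpoch_inf_diff) simp
      \<comment> \<open>The truncated product is accurate only to order
        \<open>2 * m - (2 * i + 1)\<close>; the prefactor \<open>q ^ (2 * i + 1)\<close> supplies
        the missing powers.\<close>
      have e: "2 * i + 1 + (2 * m - (2 * i + 1)) = 2 * m"
        using i by simp
      from \<open>q ^ (2 * m - (2 * i + 1)) dvd D\<close>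
      have "q ^ (2 * i + 1) * q ^ (2 * m - (2 * i + 1)) dvd q ^ (2 * i + 1) * D"
        by (rule mult_dvd_mono[OF dvd_refl])
      then have "q ^ (2 * m) dvd q ^ (2 * i + 1) * D"
        using i by (simp only: e flip: power_add)
      then show "q ^ (2 * m) dvd A * q ^ (2 * i + 1) * D"
        by (simp only: mult.assoc dvd_mult)
    qed
    moreover have "q ^ (2 * m) dvd W - S'"
      unfolding W_def S'_def sum_P_do_eq[symmetric] q_def A_def
      by (rule fps_X_power_dvd_infsum_P_do_diff)
    \<comment> \<open>After \<open>m\<close> iterations the argument of h is divisible by
      \<open>q ^ (2 * m)\<close>, so the remainder is the theta series \<open>T\<close> to that
      order.\<close>
    moreover have "q ^ (2 * m) dvd phi_prod (A * q ^ (2 * m)) - T"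
      unfolding T_def q_def by (rule fps_X_power_dvd_phi_prod_diff) simp
    ultimately have "q ^ (2 * m) dvd (S - S') - (W - S') + (phi_prod (A * q ^ (2 * m)) - T)"
      by (rule dvd_add[OF dvd_diff])
    also have "\<dots> = phi_prod A - (W + T)"
      using phi_prod_iterate[of A m] by (simp add: S_def q_def)
    finally show "fps_X ^ m dvd phi_prod A - (W + T)"
      unfolding q_def by (rule dvd_trans[rotated]) (simp add: le_imp_power_dvd)
  qed
  then show ?thesis
    unfolding phi_prod_def W_def T_def q_def phi_eq_suminf by simp
qed

end
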